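(* $\mathrm{SAT}(\aleph_0)$ implies $\operatorname{cov}(\mathcal{M})=\mathfrak{c}$.
   Context: All ultrafilters are nonprincipal. For a cardinal $\kappa$, $\mathrm{SAT}(\kappa)$ is the statement: there exists a nonprincipal ultrafilter $U$ over $\omega$ such that for every countable first-order language $L$ and every sequence $(\mathcal{A}_i)_{i\in\omega}$ of $L$-structures each of size $\le\kappa$, the ultraproduct $\prod_{i\in\omega}\mathcal{A}_i/U$ is saturated (i.e. $|M|$-saturated, $M$ the ultraproduct). $\operatorname{cov}(\mathcal{M})$ is the least number of meager subsets of the reals needed to cover the reals, and $\mathfrak{c}=2^{\aleph_0}$. *)

theory Defs
  imports "HOL-Analysis.Analysis"
begin

unbundle cardinal_syntax

text \<open>First-order logic with equality. Symbols carry their arity through the language; constants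
  are function symbols of arity 0.\<close>

record ('f, 'r) lang =
  fun_syms :: "'f set"
  fun_ar :: "'f \<Rightarrow> nat"
  rel_syms :: "'r set"
  rel_ar :: "'r \<Rightarrow> nat"

datatype 'f trm = Var nat | App 'f "'f trm list"

datatype ('f, 'r) form =
    Eq "'f trm" "'f trm"
  | Rel 'r "'f trm list"
  | Neg "('f, 'r) form"
  | Conj "('f, 'r) form" "('f, 'r) form"
  | Ex nat "('f, 'r) form"

fun trm_of :: "('f, 'r) lang \<Rightarrow> 'f trm \<Rightarrow> bool" where
  "trm_of L (Var n) \<longleftrightarrow> True"
| "trm_of L (App f ts) \<longleftrightarrow>
     f \<in> fun_syms L \<and> length ts = fun_ar L f \<and> (\<forall>t \<in> set ts. trm_of L t)"

primrec form_of :: "('f, 'r) lang \<Rightarrow> ('f, 'r) form \<Rightarrow> bool" where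
  "form_of L (Eq s t) \<longleftrightarrow> trm_of L s \<and> trm_of L t"
| "form_of L (Rel r ts) \<longleftrightarrow>
     r \<in> rel_syms L \<and> length ts = rel_ar L r \<and> (\<forall>t \<in> set ts. trm_of L t)"
| "form_of L (Neg p) \<longleftrightarrow> form_of L p"
| "form_of L (Conj p q) \<longleftrightarrow> form_of L p \<and> form_of L q"
| "form_of L (Ex n p) \<longleftrightarrow> form_of L p"

fun trm_vars :: "'f trm \<Rightarrow> nat set" where
  "trm_vars (Var n) = {n}"
| "trm_vars (App f ts) = (\<Union>t \<in> set ts. trm_vars t)"

primrec free_vars :: "('f, 'r) form \<Rightarrow> nat set" where
  "free_vars (Eq s t) = trm_vars s \<union> trm_vars t"
| "free_vars (Rel r ts) = (\<Union>t \<in> set ts. trm_vars t)"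
| "free_vars (Neg p) = free_vars p"
| "free_vars (Conj p q) = free_vars p \<union> free_vars q"
| "free_vars (Ex n p) = free_vars p - {n}"

record ('f, 'r, 'a) struct =
  universe :: "'a set"
  fun_int :: "'f \<Rightarrow> 'a list \<Rightarrow> 'a"
  rel_int :: "'r \<Rightarrow> 'a list \<Rightarrow> bool"

text \<open>The values of \<^const>\<open>fun_int\<close> and \<^const>\<open>rel_int\<close> on symbols outside the language, or on
  argument lists of the wrong length or leaving the universe, are irrelevant.\<close>

definition structure_of :: "('f, 'r) lang \<Rightarrow> ('f, 'r, 'a) struct \<Rightarrow> bool" where
  "structure_of L M \<longleftrightarrow> universe M \<noteq> {} \<and>
     (\<forall>f \<in> fun_syms L. \<forall>as. length as = fun_ar L f \<and> set as \<subseteq> universe M \<longrightarrow> fun_int M f as \<in> universe M)"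

primrec trm_val :: "('f, 'r, 'a) struct \<Rightarrow> (nat \<Rightarrow> 'a) \<Rightarrow> 'f trm \<Rightarrow> 'a" where
  "trm_val M e (Var n) = e n"
| "trm_val M e (App f ts) = fun_int M f (map (trm_val M e) ts)"

primrec sat :: "('f, 'r, 'a) struct \<Rightarrow> (nat \<Rightarrow> 'a) \<Rightarrow> ('f, 'r) form \<Rightarrow> bool" where
  "sat M e (Eq s t) \<longleftrightarrow> trm_val M e s = trm_val M e t"
| "sat M e (Rel r ts) \<longleftrightarrow> rel_int M r (map (trm_val M e) ts)"
| "sat M e (Neg p) \<longleftrightarrow> \<not> sat M e p"
| "sat M e (Conj p q) \<longleftrightarrow> sat M e p \<and> sat M e q"
| "sat M e (Ex n p) \<longleftrightarrow> (\<exists>a \<in> universe M. sat M (e(n := a)) p)"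

text \<open>The language with a new constant \<^term>\<open>Inr a\<close> for each \<^term>\<open>a \<in> A\<close>, and the expansion
  interpreting each new constant by the element it names.\<close>

definition lang_params :: "('f, 'r) lang \<Rightarrow> 'a set \<Rightarrow> ('f + 'a, 'r) lang" where
  "lang_params L A =
     \<lparr>fun_syms = Inl ` fun_syms L \<union> Inr ` A,
      fun_ar = case_sum (fun_ar L) (\<lambda>_. 0),
      rel_syms = rel_syms L,
      rel_ar = rel_ar L\<rparr>"

definition struct_params :: "('f, 'r, 'a) struct \<Rightarrow> ('f + 'a, 'r, 'a) struct" where
  "struct_params M =
     \<lparr>universe = universe M,
      fun_int = case_sum (fun_int M) (\<lambda>a _. a),
      rel_int = rel_int M\<rparr>"

text \<open>A 1-type over \<^term>\<open>A\<close>, not necessarily complete: a set of formulas with parameters in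
  \<^term>\<open>A\<close> and at most the variable 0 free, finitely satisfiable in \<^term>\<open>M\<close>. As no other
  variable is free, a constant assignment suffices to evaluate its formulas.\<close>

definition type_over ::
  "('f, 'r) lang \<Rightarrow> ('f, 'r, 'a) struct \<Rightarrow> 'a set \<Rightarrow> ('f + 'a, 'r) form set \<Rightarrow> bool" where
  "type_over L M A p \<longleftrightarrow>
     (\<forall>\<phi> \<in> p. form_of (lang_params L A) \<phi> \<and> free_vars \<phi> \<subseteq> {0}) \<and>
     (\<forall>q. finite q \<and> q \<subseteq> p \<longrightarrow> (\<exists>b \<in> universe M. \<forall>\<phi> \<in> q. sat (struct_params M) (\<lambda>_. b) \<phi>))"

definition realizes :: "('f, 'r, 'a) struct \<Rightarrow> 'a \<Rightarrow> ('f + 'a, 'r) form set \<Rightarrow> bool" where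
  "realizes M b p \<longleftrightarrow> (\<forall>\<phi> \<in> p. sat (struct_params M) (\<lambda>_. b) \<phi>)"

definition card_saturated :: "'k rel \<Rightarrow> ('f, 'r) lang \<Rightarrow> ('f, 'r, 'a) struct \<Rightarrow> bool" where
  "card_saturated \<kappa> L M \<longleftrightarrow>
     (\<forall>A p. A \<subseteq> universe M \<and> |A| <o \<kappa> \<and> type_over L M A p \<longrightarrow> (\<exists>b \<in> universe M. realizes M b p))"

definition saturated :: "('f, 'r) lang \<Rightarrow> ('f, 'r, 'a) struct \<Rightarrow> bool" where
  "saturated L M \<longleftrightarrow> card_saturated |universe M| L M"


text \<open>The members of an ultrafilter \<^term>\<open>U\<close> are the sets \<^term>\<open>{i. P i}\<close> with
  \<^term>\<open>eventually P U\<close>.\<close>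

definition nonprincipal_ultrafilter :: "'i filter \<Rightarrow> bool" where
  "nonprincipal_ultrafilter U \<longleftrightarrow>
     U \<noteq> bot \<and>
     (\<forall>P. eventually P U \<or> eventually (\<lambda>i. \<not> P i) U) \<and>
     (\<forall>i. \<not> eventually (\<lambda>j. j = i) U)"

definition ultra_eq :: "'i filter \<Rightarrow> ('i \<Rightarrow> ('f, 'r, 'a) struct) \<Rightarrow> ('i \<Rightarrow> 'a) rel" where
  "ultra_eq U A =
     {(g, h). g \<in> (\<Pi> i \<in> UNIV. universe (A i)) \<and> h \<in> (\<Pi> i \<in> UNIV. universe (A i)) \<and>
        eventually (\<lambda>i. g i = h i) U}"

definition class_rep :: "('i \<Rightarrow> 'a) set \<Rightarrow> 'i \<Rightarrow> 'a" where
  "class_rep c = (SOME g. g \<in> c)"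

definition ultraproduct ::
  "'i filter \<Rightarrow> ('i \<Rightarrow> ('f, 'r, 'a) struct) \<Rightarrow> ('f, 'r, ('i \<Rightarrow> 'a) set) struct" where
  "ultraproduct U A =
     \<lparr>universe = (\<Pi> i \<in> UNIV. universe (A i)) // ultra_eq U A,
      fun_int = (\<lambda>f cs. ultra_eq U A `` {\<lambda>i. fun_int (A i) f (map (\<lambda>c. class_rep c i) cs)}),
      rel_int = (\<lambda>r cs. eventually (\<lambda>i. rel_int (A i) r (map (\<lambda>c. class_rep c i) cs)) U)\<rparr>"

lemma equiv_ultra_eq: "equiv (\<Pi> i \<in> UNIV. universe (A i)) (ultra_eq U A)"
proof (rule equivI)
  show "ultra_eq U A \<subseteq> (\<Pi> i \<in> UNIV. universe (A i)) \<times> (\<Pi> i \<in> UNIV. universe (A i))"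
    unfolding ultra_eq_def by auto
  show "refl_on (\<Pi> i \<in> UNIV. universe (A i)) (ultra_eq U A)"
    unfolding refl_on_def ultra_eq_def by auto
  show "sym (ultra_eq U A)"
    by (rule symI) (auto simp: ultra_eq_def elim: eventually_mono)
  show "trans (ultra_eq U A)"
  proof (rule transI)
    fix f g h
    assume fg: "(f, g) \<in> ultra_eq U A" and gh: "(g, h) \<in> ultra_eq U A"
    then have "eventually (\<lambda>i. f i = g i) U" "eventually (\<lambda>i. g i = h i) U"
      by (simp_all add: ultra_eq_def)
    then have "eventually (\<lambda>i. f i = h i) U"
      by eventually_elim simp
    with fg gh show "(f, h) \<in> ultra_eq U A"
      by (simp add: ultra_eq_def)
  qed
qed

lemma class_rep_in:
  assumes "c \<in> universe (ultraproduct U A)"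
  shows "class_rep c \<in> c" "class_rep c i \<in> universe (A i)"
proof -
  have c: "c \<in> (\<Pi> i \<in> UNIV. universe (A i)) // ultra_eq U A"
    using assms by (simp add: ultraproduct_def)
  then have "c \<noteq> {}"
    using in_quotient_imp_non_empty[OF equiv_ultra_eq] by blast
  then show "class_rep c \<in> c"
    unfolding class_rep_def by (simp add: some_in_eq)
  with in_quotient_imp_subset[OF equiv_ultra_eq c] show "class_rep c i \<in> universe (A i)"
    by auto
qed

lemma structure_of_ultraproduct:
  assumes "\<And>i. structure_of L (A i)"
  shows "structure_of L (ultraproduct U A)"
  unfolding structure_of_def
proof (intro conjI ballI allI impI)
  have "(\<lambda>i. SOME a. a \<in> universe (A i)) \<in> (\<Pi> i \<in> UNIV. universe (A i))"
    using assms by (auto simp: structure_of_def some_in_eq)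
  then show "universe (ultraproduct U A) \<noteq> {}"
    by (auto simp: ultraproduct_def quotient_def)
next
  fix f cs
  assume f: "f \<in> fun_syms L"
    and cs: "length cs = fun_ar L f \<and> set cs \<subseteq> universe (ultraproduct U A)"
  have "fun_int (A i) f (map (\<lambda>c. class_rep c i) cs) \<in> universe (A i)" for i
  proof -
    have "set (map (\<lambda>c. class_rep c i) cs) \<subseteq> universe (A i)"
    proof
      fix a
      assume "a \<in> set (map (\<lambda>c. class_rep c i) cs)"
      then obtain c where "c \<in> set cs" "a = class_rep c i"
        by auto
      with cs class_rep_in(2)[of c U A i] show "a \<in> universe (A i)"
        by (simp add: subset_iff)
    qed
    with assms[of i] f cs show ?thesis
      unfolding structure_of_def by simp
  qed
  then show "fun_int (ultraproduct U A) f cs \<in> universe (ultraproduct U A)"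
    by (auto simp: ultraproduct_def intro!: quotientI)
qed

text \<open>Up to renaming symbols, every countable language has its symbols in \<^typ>\<open>nat\<close>; up to
  isomorphism, every structure of size at most \<^term>\<open>\<kappa>\<close> has its universe in the
  type on which the cardinal \<^term>\<open>\<kappa>\<close> lives.\<close>

definition SAT :: "'k rel \<Rightarrow> bool" where
  "SAT \<kappa> \<longleftrightarrow>
     (\<exists>U :: nat filter. nonprincipal_ultrafilter U \<and>
        (\<forall>(L :: (nat, nat) lang) (A :: nat \<Rightarrow> (nat, nat, 'k) struct).
           (\<forall>i. structure_of L (A i) \<and> |universe (A i)| \<le>o \<kappa>) \<longrightarrow>
           saturated L (ultraproduct U A)))"


definition nowhere_dense :: "'a::topological_space set \<Rightarrow> bool" where
  "nowhere_dense S \<longleftrightarrow> interior (closure S) = {}"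

definition meager :: "'a::topological_space set \<Rightarrow> bool" where
  "meager S \<longleftrightarrow> (\<exists>N :: nat \<Rightarrow> 'a set. (\<forall>n. nowhere_dense (N n)) \<and> S = (\<Union>n. N n))"

definition meager_cover :: "real set set \<Rightarrow> bool" where
  "meager_cover C \<longleftrightarrow> (\<forall>S \<in> C. meager S) \<and> \<Union> C = UNIV"

definition cov_meager :: "real set rel" where
  "cov_meager = (SOME r. (\<exists>C. meager_cover C \<and> r = |C| ) \<and> (\<forall>C. meager_cover C \<longrightarrow> r \<le>o |C| ))"

lemma meager_cover_singletons: "meager_cover (range (\<lambda>x. {x}))"
proof -
  have "meager {x}" for x :: real
    unfolding meager_def nowhere_dense_def by (rule exI[of _ "\<lambda>_. {x}"]) auto
  then show ?thesis
    unfolding meager_cover_def by auto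
qed

lemma cov_meager_least:
  "(\<exists>C. meager_cover C \<and> cov_meager = |C| ) \<and> (\<forall>C. meager_cover C \<longrightarrow> cov_meager \<le>o |C| )"
proof -
  let ?R = "{|C| | C. meager_cover C}"
  have "?R \<noteq> {}" "\<forall>r \<in> ?R. Card_order r"
    using meager_cover_singletons by (auto simp: card_of_Card_order)
  from exists_minim_Card_order[OF this] obtain r where "r \<in> ?R" "\<forall>r' \<in> ?R. r \<le>o r'"
    by blast
  then have "(\<exists>C. meager_cover C \<and> r = |C| ) \<and> (\<forall>C. meager_cover C \<longrightarrow> r \<le>o |C| )"
    by blast
  then show ?thesis
    unfolding cov_meager_def by (rule someI)
qed

definition continuum :: "(nat \<Rightarrow> bool) rel" where
  "continuum = ctwo ^c natLeq"

end

theory Submission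
  imports Defs
begin

text \<open>Saturation of an ultraproduct of countable structures yields, for any fewer than continuum many
  functions on \<open>\<nat>\<close>, a single function that agrees infinitely often with each of them: the guess on
  the \<open>i\<close>-th of disjoint finite sets of growing size is the \<open>i\<close>-th coordinate of an element realizing
  a type. As in Bartoszynski's characterization of the covering number of the meager ideal, two such
  guesses produce a real outside fewer than continuum many nowhere dense sets. The first one cuts the
  binary digits into blocks such that, for each of the sets, infinitely many blocks are long enough
  to force a real out of it; the second one guesses digits on these blocks.\<close>

section \<open>Guessing functions by saturation\<close>

lemma continuum_eq: "continuum = |UNIV :: (nat \<Rightarrow> bool) set|"
  by (simp add: continuum_def cexp_def ctwo_def Field_card_of Field_natLeq Func_def)

text \<open>Removing finitely many points, one at a time, leaves a set in \<open>U\<close>; so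
  indices may be taken large in arguments modulo \<open>U\<close>.\<close>

lemma nonprincipal_ultrafilter_le_sequentially:
  fixes U :: "nat filter"
  assumes "nonprincipal_ultrafilter U"
  shows "U \<le> sequentially"
proof -
  have ne: "eventually (\<lambda>j. j \<noteq> i) U" for i
    using assms unfolding nonprincipal_ultrafilter_def by metis
  have "eventually (\<lambda>j. n \<le> j) U" for n
  proof (induction n)
    case (Suc n)
    from Suc ne[of n] show ?case by eventually_elim simp
  qed simp
  then show ?thesis
    by (intro filter_leI) (metis (mono_tags, lifting) eventually_mono eventually_sequentially)
qed

text \<open>The elements of the \<open>i\<close>-th structure code functions on \<open>{..i}\<close>, and the type asks for a code that
  agrees somewhere with each parameter. In the \<open>i\<close>-th structure any \<open>i + 1\<close> such conditions are met
  at once by diagonalising, which gives finite satisfiability.\<close>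

definition agree_lang :: "(nat, nat) lang" where
  "agree_lang = \<lparr>fun_syms = {}, fun_ar = \<lambda>_. 0, rel_syms = {0}, rel_ar = \<lambda>_. 2\<rparr>"

definition agree_struct :: "nat \<Rightarrow> (nat, nat, nat) struct" where
  "agree_struct i = \<lparr>universe = UNIV, fun_int = \<lambda>_ _. 0,
     rel_int = \<lambda>_ xs. \<exists>j\<le>i. (from_nat (xs ! 0) :: nat list) ! j = (from_nat (xs ! 1) :: nat list) ! j\<rparr>"

definition agree_form :: "'a \<Rightarrow> (nat + 'a, nat) form" where
  "agree_form c = Rel 0 [Var 0, App (Inr c) []]"

lemma universe_agree_struct [simp]: "universe (agree_struct i) = UNIV"
  by (simp add: agree_struct_def)

lemma structure_of_agree: "structure_of agree_lang (agree_struct i)"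
  by (simp add: structure_of_def agree_struct_def agree_lang_def)

definition agree_class :: "nat filter \<Rightarrow> (nat \<Rightarrow> nat) \<Rightarrow> (nat \<Rightarrow> nat) set" where
  "agree_class U g = ultra_eq U agree_struct `` {g}"

lemma agree_class_in [simp]: "agree_class U g \<in> universe (ultraproduct U agree_struct)"
  by (auto simp: agree_class_def ultraproduct_def intro!: quotientI)

lemma eventually_class_rep: "eventually (\<lambda>i. class_rep (agree_class U g) i = g i) U"
proof -
  have "class_rep (agree_class U g) \<in> agree_class U g"
    using agree_class_in by (rule class_rep_in)
  then show ?thesis
    by (auto simp: agree_class_def ultra_eq_def eq_commute)
qed

lemma sat_agree_form:
  "sat (struct_params (ultraproduct U agree_struct)) (\<lambda>_. b) (agree_form c) \<longleftrightarrow>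
     eventually (\<lambda>i. \<exists>j\<le>i. (from_nat (class_rep b i) :: nat list) ! j
                          = (from_nat (class_rep c i) :: nat list) ! j) U"
  by (simp add: agree_form_def struct_params_def ultraproduct_def agree_struct_def)

text \<open>A 0-1 sequence goes to the class of its coded initial segments; two sequences differing
  at \<open>n\<close> have different codes at every \<open>i > n\<close>. Hence saturation covers
  all parameter sets smaller than the continuum.\<close>

lemma continuum_le_ultraproduct:
  assumes "nonprincipal_ultrafilter U"
  shows "continuum \<le>o |universe (ultraproduct U agree_struct)|"
proof -
  define F where "F x = agree_class U (\<lambda>i. to_nat (map x [0..<i]))" for x :: "nat \<Rightarrow> bool"
  have "inj F"
  proof (rule injI, rule ext)
    fix x y :: "nat \<Rightarrow> bool" and n
    assume "F x = F y"
    with eventually_class_rep[of U "\<lambda>i. to_nat (map x [0..<i])"]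
    have "eventually (\<lambda>i. class_rep (F y) i = to_nat (map x [0..<i])) U"
      by (simp add: F_def)
    moreover have "eventually (\<lambda>i. class_rep (F y) i = to_nat (map y [0..<i])) U"
      unfolding F_def by (rule eventually_class_rep)
    moreover have "eventually (\<lambda>i. i > n) U"
      using nonprincipal_ultrafilter_le_sequentially[OF assms] eventually_gt_at_top
      by (rule filter_leD)
    ultimately have "eventually (\<lambda>i. x n = y n) U"
      by eventually_elim auto
    then show "x n = y n"
      using assms by (auto simp: nonprincipal_ultrafilter_def eventually_const_iff)
  qed
  then show ?thesis
    unfolding continuum_eq by (rule card_of_ordLeqI) (simp add: F_def)
qed

lemma type_over_agree:
  assumes U: "nonprincipal_ultrafilter U"
    and A: "A \<subseteq> universe (ultraproduct U agree_struct)"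
  shows "type_over agree_lang (ultraproduct U agree_struct) A (agree_form ` A)"
  unfolding type_over_def
proof (intro conjI allI impI)
  show "\<forall>\<phi>\<in>agree_form ` A. form_of (lang_params agree_lang A) \<phi> \<and> free_vars \<phi> \<subseteq> {0}"
    by (auto simp: agree_form_def lang_params_def agree_lang_def)
next
  fix q assume "finite q \<and> q \<subseteq> agree_form ` A"
  then obtain B where "finite B" and q: "q = agree_form ` B"
    by (meson finite_subset_image)
  then obtain cs where cs: "set cs = B"
    using finite_list by blast
  \<comment> \<open>Diagonal witness: entry \<open>j\<close> copies entry \<open>j\<close> of the
    \<open>j\<close>-th parameter. Only \<open>j < length cs\<close> matters; beyond that
    \<open>cs ! j\<close> is unspecified.\<close>
  define v where "v i = map (\<lambda>j. (from_nat (class_rep (cs ! j) i) :: nat list) ! j) [0..<Suc i]" for i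
  define b where "b = agree_class U (\<lambda>i. to_nat (v i))"
  have "sat (struct_params (ultraproduct U agree_struct)) (\<lambda>_. b) (agree_form c)" if "c \<in> B" for c
  proof -
    from that cs obtain j where j: "j < length cs" "cs ! j = c"
      by (metis in_set_conv_nth)
    have "eventually (\<lambda>i. i \<ge> j) U"
      using nonprincipal_ultrafilter_le_sequentially[OF U] eventually_ge_at_top
      by (rule filter_leD)
    moreover have "eventually (\<lambda>i. class_rep b i = to_nat (v i)) U"
      unfolding b_def by (rule eventually_class_rep)
    ultimately show ?thesis
      unfolding sat_agree_form
    proof eventually_elim
      case (elim i)
      then have "(from_nat (class_rep b i) :: nat list) ! j = (from_nat (class_rep c i) :: nat list) ! j"
        using j by (simp add: v_def nth_append del: upt_Suc)
      with elim show ?case by blast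
    qed
  qed
  then show "\<exists>b\<in>universe (ultraproduct U agree_struct).
      \<forall>\<phi>\<in>q. sat (struct_params (ultraproduct U agree_struct)) (\<lambda>_. b) \<phi>"
    unfolding q by (intro bexI[of _ b]) (auto simp: b_def)
qed

text \<open>The part \<open>j \<le> n\<close> of row \<open>n\<close> is coded by one element of the
  \<open>n\<close>-th structure. A realization of the type agrees with each coded function somewhere
  on \<open>U\<close>-almost every row, hence on infinitely many rows.\<close>

lemma SAT_infinitely_often_equal_nat:
  fixes f :: "'i \<Rightarrow> nat \<times> nat \<Rightarrow> nat"
  assumes "SAT natLeq" and I: "|I| <o continuum"
  shows "\<exists>g. \<forall>i\<in>I. infinite {n. f i n = g n}"
proof -
  obtain U :: "nat filter" where U: "nonprincipal_ultrafilter U"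
    and sat: "\<And>(L :: (nat, nat) lang) (A :: nat \<Rightarrow> (nat, nat, nat) struct).
        (\<forall>i. structure_of L (A i) \<and> |universe (A i)| \<le>o natLeq) \<Longrightarrow> saturated L (ultraproduct U A)"
    using assms(1) unfolding SAT_def by blast
  let ?M = "ultraproduct U agree_struct"
  define code where "code k n = to_nat (map (\<lambda>j. f k (n, j)) [0..<Suc n])" for k n
  define A where "A = (\<lambda>k. agree_class U (code k)) ` I"
  have "|A| \<le>o |I|"
    unfolding A_def by (rule card_of_image)
  then have "|A| <o |universe ?M|"
    using I continuum_le_ultraproduct[OF U] ordLeq_ordLess_trans ordLess_ordLeq_trans by blast
  moreover have "A \<subseteq> universe ?M"
    by (auto simp: A_def)
  moreover have "saturated agree_lang ?M"
    by (rule sat) (simp add: structure_of_agree ordIso_imp_ordLeq[OF card_of_nat])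
  ultimately obtain b where b: "realizes ?M b (agree_form ` A)"
    unfolding saturated_def card_saturated_def using type_over_agree[OF U] by blast
  define g where "g = (\<lambda>(n, j). (from_nat (class_rep b n) :: nat list) ! j)"
  have "infinite {n. f k n = g n}" if "k \<in> I" for k
  proof -
    have "eventually (\<lambda>n. \<exists>j\<le>n. (from_nat (class_rep b n) :: nat list) ! j
        = (from_nat (class_rep (agree_class U (code k)) n) :: nat list) ! j) U"
      using b that unfolding realizes_def A_def by (auto simp: sat_agree_form)
    with eventually_class_rep[of U "code k"]
    have ev: "eventually (\<lambda>n. \<exists>j. f k (n, j) = g (n, j)) U"
    proof eventually_elim
      case (elim n)
      then obtain j where j: "j \<le> n" "(from_nat (class_rep b n) :: nat list) ! j = (from_nat (code k n) :: nat list) ! j"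
        by auto
      then have "f k (n, j) = g (n, j)"
        by (simp add: g_def code_def nth_append del: upt_Suc)
      then show ?case ..
    qed
    have "infinite {n. \<exists>j. f k (n, j) = g (n, j)}"
      unfolding infinite_nat_iff_unbounded_le
    proof
      fix m
      have "eventually (\<lambda>n. n \<ge> m) U"
        using nonprincipal_ultrafilter_le_sequentially[OF U] eventually_ge_at_top
        by (rule filter_leD)
      with ev have "eventually (\<lambda>n. n \<ge> m \<and> (\<exists>j. f k (n, j) = g (n, j))) U"
        by eventually_elim simp
      moreover have "U \<noteq> bot"
        using U by (simp add: nonprincipal_ultrafilter_def)
      ultimately show "\<exists>n\<ge>m. n \<in> {n. \<exists>j. f k (n, j) = g (n, j)}"
        using eventually_happens by fastforce
    qed
    moreover have "{n. \<exists>j. f k (n, j) = g (n, j)} = fst ` {n. f k n = g n}"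
      by force
    ultimately show ?thesis
      by (metis finite_imageI)
  qed
  then show ?thesis by blast
qed

text \<open>Transfer along the pairing bijection and a coding of values. General countable values
  allow guessing lists of pairs later.\<close>

lemma SAT_infinitely_often_equal:
  fixes f :: "'i \<Rightarrow> nat \<Rightarrow> 'b::countable"
  assumes "SAT natLeq" and "|I| <o continuum"
  shows "\<exists>g. \<forall>i\<in>I. infinite {n. f i n = g n}"
proof -
  obtain g where g: "\<And>i. i \<in> I \<Longrightarrow> infinite {p. to_nat (f i (prod_encode p)) = g p}"
    using SAT_infinitely_often_equal_nat[OF assms, of "\<lambda>i p. to_nat (f i (prod_encode p))"] by blast
  have "infinite {n. f i n = from_nat (g (prod_decode n))}" if "i \<in> I" for i
  proof
    assume fin: "finite {n. f i n = from_nat (g (prod_decode n))}"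
    have "prod_encode ` {p. to_nat (f i (prod_encode p)) = g p} \<subseteq> {n. f i n = from_nat (g (prod_decode n))}"
      by clarsimp (metis from_nat_to_nat)
    then have "finite {p. to_nat (f i (prod_encode p)) = g p}"
      using fin by (meson finite_imageD finite_subset inj_prod_encode)
    with g[OF that] show False by blast
  qed
  then show ?thesis
    by (intro exI[of _ "\<lambda>n. from_nat (g (prod_decode n))"] ballI)
qed

section \<open>Dyadic intervals avoiding a nowhere dense set\<close>

text \<open>For \<open>b < 2 ^ m\<close>, these are the reals in the unit interval with a binary
  expansion starting with the \<open>m\<close> digits of \<open>b\<close>. Closedness is for the
  compactness argument on nested intervals.\<close>

definition dyadic :: "nat \<Rightarrow> nat \<Rightarrow> real set" where
  "dyadic b m = {real b / 2 ^ m .. (real b + 1) / 2 ^ m}"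

lemma dyadic_refine:
  assumes "m \<le> M" "t < 2 ^ (M - m)"
  shows "dyadic (b * 2 ^ (M - m) + t) M \<subseteq> dyadic b m"
proof -
  have e: "(2::real) ^ M = 2 ^ m * 2 ^ (M - m)"
    using assms by (simp flip: power_add)
  have "real (Suc t) \<le> real (2 ^ (M - m))"
    unfolding of_nat_le_iff using assms(2) by (rule Suc_leI)
  then have "real (b * 2 ^ (M - m) + t) + 1 \<le> (real b + 1) * 2 ^ (M - m)"
    by (simp add: distrib_right)
  then have "(real (b * 2 ^ (M - m) + t) + 1) / 2 ^ M \<le> ((real b + 1) * 2 ^ (M - m)) / 2 ^ M"
    by (rule divide_right_mono) simp
  moreover have "(real b * 2 ^ (M - m)) / 2 ^ M \<le> real (b * 2 ^ (M - m) + t) / 2 ^ M"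
    by (rule divide_right_mono) auto
  ultimately show ?thesis
    unfolding dyadic_def atLeastatMost_subset_iff by (simp add: e)
qed

lemma nowhere_dense_dyadic:
  assumes "nowhere_dense N"
  shows "\<exists>M\<ge>m. \<exists>t<2 ^ (M - m). dyadic (b * 2 ^ (M - m) + t) M \<inter> N = {}"
proof -
  define J where "J = {real b / 2 ^ m <..< (real b + 1) / 2 ^ m}"
  have "real b / 2 ^ m < (real b + 1) / 2 ^ m"
    by (intro divide_strict_right_mono) auto
  then have "J \<noteq> {}" "open J"
    by (auto simp: J_def)
  with assms have "\<not> J \<subseteq> closure N"
    unfolding nowhere_dense_def by (metis interior_maximal subset_empty)
  then obtain y where y: "y \<in> J - closure N" by blast
  moreover have "open (J - closure N)"
    using \<open>open J\<close> by (simp add: open_Diff)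
  ultimately obtain e where e: "e > 0" "ball y e \<subseteq> J - closure N"
    by (meson open_contains_ball)
  obtain k where k: "(1/2 :: real) ^ k < e"
    using real_arch_pow_inv[OF e(1), of "1/2"] by auto
  define M where "M = max k m"
  have M: "m \<le> M" "1 / 2 ^ M < e"
  proof -
    have "(1/2 :: real) ^ M \<le> (1/2) ^ k"
      by (rule power_decreasing) (auto simp: M_def)
    with k show "1 / 2 ^ M < e" by (simp add: power_one_over)
  qed (simp add: M_def)
  have y0: "0 < y"
  proof -
    have "0 \<le> real b / 2 ^ m" by simp
    also have "\<dots> < y" using y by (simp add: J_def)
    finally show ?thesis .
  qed
  \<comment> \<open>Index of the level-\<open>M\<close> interval around \<open>y\<close>; it is
    short enough to fit into the ball.\<close>
  define c where "c = nat \<lfloor>y * 2 ^ M\<rfloor>"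
  have c: "real c \<le> y * 2 ^ M" "y * 2 ^ M < real c + 1"
    using y0 by (auto simp: c_def)
  have sub: "dyadic c M \<subseteq> ball y e"
  proof
    fix z assume "z \<in> dyadic c M"
    then have z: "real c \<le> z * 2 ^ M" "z * 2 ^ M \<le> real c + 1"
      by (auto simp: dyadic_def field_simps)
    have "\<bar>y - z\<bar> * 2 ^ M = \<bar>y * 2 ^ M - z * 2 ^ M\<bar>"
      by (simp add: abs_mult flip: left_diff_distrib)
    also have "\<dots> \<le> 1" using c z by linarith
    finally have "\<bar>y - z\<bar> \<le> 1 / 2 ^ M" by (simp add: field_simps)
    with M show "z \<in> ball y e" by (simp add: dist_real_def)
  qed
  have "(2::real) ^ M = 2 ^ m * 2 ^ (M - m)"
    using M by (simp flip: power_add)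
  then have ends: "real b / 2 ^ m = real b * 2 ^ (M - m) / 2 ^ M"
      "(real b + 1) / 2 ^ m = (real b + 1) * 2 ^ (M - m) / 2 ^ M"
    by simp_all
  have "real c / 2 ^ M \<in> dyadic c M" "(real c + 1) / 2 ^ M \<in> dyadic c M"
    by (auto simp: dyadic_def divide_right_mono)
  then have "real c / 2 ^ M \<in> J" "(real c + 1) / 2 ^ M \<in> J"
    using sub e(2) by blast+
  \<comment> \<open>Both endpoints lie in \<open>J\<close>; scaled by \<open>2 ^ M\<close> this
    becomes inequalities between integers, so \<open>c\<close> extends the digits of
    \<open>b\<close>.\<close>
  then have "real b * 2 ^ (M - m) < real c" "real c + 1 < (real b + 1) * 2 ^ (M - m)"
    unfolding J_def ends by (auto simp: divide_less_cancel)
  then have "real (b * 2 ^ (M - m)) < real c" "real (c + 1) < real ((b + 1) * 2 ^ (M - m))"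
    by (simp_all add: algebra_simps)
  then have "b * 2 ^ (M - m) < c" "c + 1 < (b + 1) * 2 ^ (M - m)"
    unfolding of_nat_less_iff by blast+
  then have "c - b * 2 ^ (M - m) < 2 ^ (M - m)" "b * 2 ^ (M - m) + (c - b * 2 ^ (M - m)) = c"
    by (auto simp: algebra_simps)
  moreover have "dyadic c M \<inter> N = {}"
    using sub e(2) closure_subset by fastforce
  ultimately show ?thesis using M by metis
qed

text \<open>Here \<open>t\<close> encodes the binary digits at positions \<open>m..<M\<close>; these digits alone must force the
  number out of \<open>N\<close>, whatever the preceding ones are.\<close>

definition escapes :: "real set \<Rightarrow> nat \<Rightarrow> nat \<Rightarrow> nat \<Rightarrow> bool" where
  "escapes N m M t \<longleftrightarrow>
     m \<le> M \<and> t < 2 ^ (M - m) \<and> (\<forall>a<2 ^ m. dyadic (a * 2 ^ (M - m) + t) M \<inter> N = {})"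

lemma digits_less:
  fixes s t :: nat
  assumes "s < 2 ^ j" "t < 2 ^ k"
  shows "s * 2 ^ k + t < 2 ^ (j + k)"
proof -
  have "s * 2 ^ k + t < (s + 1) * 2 ^ k" using assms by simp
  also have "\<dots> \<le> 2 ^ j * 2 ^ k" using assms by (intro mult_right_mono) auto
  finally show ?thesis by (simp add: power_add)
qed

text \<open>The finitely many prefixes \<open>a\<close> are treated one after another: the digit
  string is lengthened to handle the next prefix, and refinement preserves what was achieved for the
  earlier ones.\<close>

lemma ex_escapes:
  assumes "nowhere_dense N"
  shows "\<exists>M t. escapes N m M t"
proof -
  have "\<exists>M\<ge>m. \<exists>t<2 ^ (M - m). \<forall>a<c. dyadic (a * 2 ^ (M - m) + t) M \<inter> N = {}" for c :: nat
  proof (induction c)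
    case 0
    show ?case by (rule exI[of _ m]) auto
  next
    case (Suc c)
    then obtain M t where M: "M \<ge> m" "t < 2 ^ (M - m)"
      and a: "\<And>a. a < c \<Longrightarrow> dyadic (a * 2 ^ (M - m) + t) M \<inter> N = {}"
      by blast
    obtain M' s where M': "M' \<ge> M" "s < 2 ^ (M' - M)"
      and s: "dyadic ((c * 2 ^ (M - m) + t) * 2 ^ (M' - M) + s) M' \<inter> N = {}"
      using nowhere_dense_dyadic[OF assms] by blast
    have d: "M' - m = (M - m) + (M' - M)" using M M' by simp
    let ?t = "t * 2 ^ (M' - M) + s"
    have eq: "a * 2 ^ (M' - m) + ?t = (a * 2 ^ (M - m) + t) * 2 ^ (M' - M) + s" for a
      unfolding d by (simp add: power_add algebra_simps)
    have "dyadic (a * 2 ^ (M' - m) + ?t) M' \<inter> N = {}" if "a < Suc c" for a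
    proof (cases "a = c")
      case False
      with that a have "dyadic (a * 2 ^ (M - m) + t) M \<inter> N = {}" by simp
      with dyadic_refine[OF M'] show ?thesis unfolding eq by blast
    next
      case True
      show ?thesis unfolding eq True by (rule s)
    qed
    moreover have "?t < 2 ^ (M' - m)"
      unfolding d using M M' by (intro digits_less)
    moreover have "m \<le> M'" using M M' by simp
    ultimately show ?case by blast
  qed
  then show ?thesis unfolding escapes_def by blast
qed

text \<open>Pad with zeros on both sides: a prefix of length \<open>m'\<close> becomes one of length
  \<open>m\<close>, and digits after \<open>M\<close> only shrink the interval.\<close>

lemma escapes_mono:
  assumes "escapes N m M t" "m' \<le> m" "M \<le> M'"
  shows "\<exists>t'. escapes N m' M' t'"
proof -
  have mM: "m \<le> M" and t: "t < 2 ^ (M - m)"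
    and N: "\<And>a. a < 2 ^ m \<Longrightarrow> dyadic (a * 2 ^ (M - m) + t) M \<inter> N = {}"
    using assms(1) unfolding escapes_def by auto
  have d: "M' - m' = (m - m') + ((M - m) + (M' - M))" using mM assms by simp
  have t': "t * 2 ^ (M' - M) + 0 < 2 ^ ((M - m) + (M' - M))"
    using t by (intro digits_less) auto
  also have "\<dots> \<le> (2::nat) ^ (M' - m')"
    unfolding d by (intro power_increasing) auto
  finally have "t * 2 ^ (M' - M) < 2 ^ (M' - m')" by simp
  moreover have "dyadic (a * 2 ^ (M' - m') + t * 2 ^ (M' - M)) M' \<inter> N = {}" if "a < 2 ^ m'" for a
  proof -
    have "a * 2 ^ (m - m') + 0 < 2 ^ (m' + (m - m'))"
      using that by (intro digits_less) auto
    then have "dyadic (a * 2 ^ (m - m') * 2 ^ (M - m) + t) M \<inter> N = {}"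
      using N assms by simp
    moreover have "a * 2 ^ (M' - m') + t * 2 ^ (M' - M)
        = (a * 2 ^ (m - m') * 2 ^ (M - m) + t) * 2 ^ (M' - M) + 0"
      unfolding d by (simp add: power_add algebra_simps)
    ultimately show ?thesis
      using dyadic_refine[OF assms(3), of 0] by fastforce
  qed
  moreover have "m' \<le> M'" using mM assms by simp
  ultimately show ?thesis unfolding escapes_def by blast
qed

section \<open>Escaping fewer than continuum many nowhere dense sets\<close>

lemma ex_block_containing:
  fixes h :: "nat \<Rightarrow> nat"
  assumes "strict_mono h" "h K \<le> n"
  shows "\<exists>k\<ge>K. h k \<le> n \<and> n < h (Suc k)"
proof -
  have "\<exists>k. n < h (K + k)"
    using strict_mono_imp_increasing[OF assms(1), of "K + Suc n"] by (intro exI[of _ "Suc n"]) simp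
  then have l: "n < h (K + (LEAST k. n < h (K + k)))"
    by (rule LeastI_ex)
  obtain j where j: "(LEAST k. n < h (K + k)) = Suc j"
    using l assms(2) by (cases "LEAST k. n < h (K + k)") auto
  then have "\<not> n < h (K + j)"
    using not_less_Least[of j "\<lambda>k. n < h (K + k)"] by simp
  with l j show ?thesis
    by (intro exI[of _ "K + j"]) auto
qed

text \<open>Iterating a function that bounds infinitely often each \<open>\<lambda>n. \<phi> i (\<phi> i n)\<close> gives the block
  boundaries. Asking for two consecutive escaping intervals after \<open>n\<close> makes sure that one of them
  lies in a single block.\<close>

lemma ex_blocks:
  assumes "SAT natLeq" "|I| <o continuum" and N: "\<And>i. i \<in> I \<Longrightarrow> nowhere_dense (N i)"
  shows "\<exists>h. strict_mono h \<and> (\<forall>i\<in>I. infinite {k. \<exists>t. escapes (N i) (h k) (h (Suc k)) t})"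
proof -
  have "\<forall>i\<in>I. \<forall>m. \<exists>M. \<exists>t. escapes (N i) m M t"
    using ex_escapes[OF N] by blast
  then obtain \<phi> where \<phi>: "\<And>i m. i \<in> I \<Longrightarrow> \<exists>t. escapes (N i) m (\<phi> i m) t"
    by metis
  obtain g where g: "\<And>i. i \<in> I \<Longrightarrow> infinite {n. \<phi> i (\<phi> i n) = g n}"
    using SAT_infinitely_often_equal[OF assms(1,2), of "\<lambda>i n. \<phi> i (\<phi> i n)"] by blast
  \<comment> \<open>A monotone majorant of \<open>g\<close> lying strictly above the identity, so
    that its iterates increase strictly.\<close>
  define G where "G n = Suc (n + (\<Sum>k\<le>n. g k))" for n
  have G: "n < G n" "g n \<le> G n" for n
    using member_le_sum[of n "{..n}" g] by (auto simp: G_def)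
  have G_mono: "G m \<le> G n" if "m \<le> n" for m n
    using that sum_mono2[of "{..n}" "{..m}" g] by (simp add: G_def add_mono)
  define h where "h k = (G ^^ k) 0" for k
  have h_Suc: "h (Suc k) = G (h k)" for k
    by (simp add: h_def)
  then have h: "strict_mono h"
    by (simp add: strict_mono_Suc_iff G)
  have "infinite {k. \<exists>t. escapes (N i) (h k) (h (Suc k)) t}" if i: "i \<in> I" for i
    unfolding infinite_nat_iff_unbounded_le
  proof
    fix K
    obtain n where n: "n \<ge> h K" "\<phi> i (\<phi> i n) = g n"
      using g[OF i] unfolding infinite_nat_iff_unbounded_le by blast
    then obtain k where k: "k \<ge> K" "h k \<le> n" "n < h (Suc k)"
      using ex_block_containing[OF h] by blast
    have le: "\<phi> i (\<phi> i n) \<le> h (Suc (Suc k))"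
      using n(2) G(2)[of n] G_mono[of n "h (Suc k)"] k by (simp add: h_Suc)
    have "(\<exists>t. escapes (N i) (h k) (h (Suc k)) t) \<or> (\<exists>t. escapes (N i) (h (Suc k)) (h (Suc (Suc k))) t)"
    \<comment> \<open>If the first interval, from \<open>n\<close> to \<open>\<phi> i n\<close>,
      overshoots block \<open>k\<close>, the second starts in or after block \<open>Suc k\<close>
      and ends by its right end.\<close>
    proof (cases "\<phi> i n \<le> h (Suc k)")
      case True
      with \<phi>[OF i, of n] k show ?thesis using escapes_mono by blast
    next
      case False
      with \<phi>[OF i, of "\<phi> i n"] le show ?thesis using escapes_mono by (meson nat_le_linear)
    qed
    with k show "\<exists>n\<ge>K. n \<in> {k. \<exists>t. escapes (N i) (h k) (h (Suc k)) t}"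
      by (metis mem_Collect_eq le_SucI)
  qed
  with h show ?thesis by blast
qed

text \<open>Greedy choice: at stage \<open>n\<close> at most \<open>n\<close> values are taken, so a
  set with more than \<open>n\<close> elements still offers a new one; otherwise any fresh number is
  used.\<close>

lemma ex_inj_choice:
  fixes A :: "nat \<Rightarrow> nat set"
  shows "\<exists>s. inj s \<and> (\<forall>n. n < card (A n) \<longrightarrow> s n \<in> A n)"
proof -
  let ?P = "\<lambda>f n r. r \<notin> f ` {..<n} \<and> (n < card (A n) \<longrightarrow> r \<in> A n)"
  have "\<exists>s. \<forall>n. ?P s n (s n)"
  proof (rule dependent_wellorder_choice)
    fix n and f :: "nat \<Rightarrow> nat"
    show "\<exists>r. ?P f n r"
    proof (cases "n < card (A n)")
      case True
      have "card (f ` {..<n}) \<le> n"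
        using card_image_le[of "{..<n}" f] by simp
      with True have "\<not> A n \<subseteq> f ` {..<n}"
        using card_mono[of "f ` {..<n}" "A n"] by fastforce
      then show ?thesis by blast
    next
      case False
      then show ?thesis
        using ex_new_if_finite[of "f ` {..<n}"] by auto
    qed
  qed (auto simp: image_iff)
  then obtain s where s: "\<And>n. ?P s n (s n)" by blast
  have "s m \<noteq> s n" if "m < n" for m n
    using s[of n] that by (metis imageI lessThan_iff)
  then have "inj s"
    by (metis injI nat_neq_iff)
  with s show ?thesis by blast
qed

lemma ex_real_with_digit_blocks:
  assumes h: "strict_mono h" and t: "\<And>k. t k < 2 ^ (h (Suc k) - h k)"
  shows "\<exists>x. \<forall>k. \<exists>a<2 ^ h k. x \<in> dyadic (a * 2 ^ (h (Suc k) - h k) + t k) (h (Suc k))"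
proof -
  \<comment> \<open>\<open>a k\<close> encodes the first \<open>h k\<close> digits; those before
    \<open>h 0\<close> are zero.\<close>
  define a where "a = rec_nat 0 (\<lambda>k b. b * 2 ^ (h (Suc k) - h k) + t k)"
  have a_Suc: "a (Suc k) = a k * 2 ^ (h (Suc k) - h k) + t k" and a_0: "a 0 = 0" for k
    by (simp_all add: a_def)
  have le: "h k \<le> h (Suc k)" for k
    using h by (simp add: strict_mono_less_eq)
  have a: "a k < 2 ^ h k" for k
  proof (induction k)
    case (Suc k)
    from digits_less[OF this t[of k]] le[of k] show ?case by (simp add: a_Suc)
  qed (simp add: a_0)
  have "decseq (\<lambda>k. dyadic (a k) (h k))"
    unfolding decseq_Suc_iff a_Suc using dyadic_refine[OF le t] by blast
  then have "\<Inter>(range (\<lambda>k. dyadic (a k) (h k))) \<noteq> {}"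
    by (intro compact_nest) (auto simp: dyadic_def divide_right_mono dest: decseqD)
  then obtain x where "\<And>k. x \<in> dyadic (a k) (h k)" by blast
  then have "\<forall>k. x \<in> dyadic (a (Suc k)) (h (Suc k))" by blast
  with a show ?thesis unfolding a_Suc by blast
qed

text \<open>Guessing, at stage \<open>n\<close>, the digits on the first \<open>n + 1\<close> escaping blocks leaves room to act on
  a block not used by the earlier guesses.\<close>

lemma SAT_escape_nowhere_dense:
  fixes N :: "'i \<Rightarrow> real set"
  assumes "SAT natLeq" "|I| <o continuum" and "\<And>i. i \<in> I \<Longrightarrow> nowhere_dense (N i)"
  shows "\<exists>x. \<forall>i\<in>I. x \<notin> N i"
proof -
  obtain h where h: "strict_mono h"
    and inf: "\<And>i. i \<in> I \<Longrightarrow> infinite {k. \<exists>t. escapes (N i) (h k) (h (Suc k)) t}"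
    using ex_blocks[OF assms(1,2), of N] assms(3) by blast
  define X where "X i = {k. \<exists>t. escapes (N i) (h k) (h (Suc k)) t}" for i
  define T where "T i k = (SOME t. escapes (N i) (h k) (h (Suc k)) t)" for i k
  have T: "escapes (N i) (h k) (h (Suc k)) (T i k)" if "k \<in> X i" for i k
    using that unfolding X_def T_def by (auto intro: someI)
  define F where "F i n = map (\<lambda>k. (k, T i k)) (map (enumerate (X i)) [0..<Suc n])" for i n
  obtain G where G: "\<And>i. i \<in> I \<Longrightarrow> infinite {n. F i n = G n}"
    using SAT_infinitely_often_equal[OF assms(1,2), of F] by blast
  obtain s where s: "inj s" "\<And>n. n < card (fst ` set (G n)) \<Longrightarrow> s n \<in> fst ` set (G n)"
    using ex_inj_choice[of "\<lambda>n. fst ` set (G n)"] by blast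
  \<comment> \<open>Block \<open>k\<close> consults the guess of the stage that \<open>s\<close>
    assigned to it. The default 0 and the \<open>mod\<close> keep \<open>t k\<close> in range even
    for wrong guesses.\<close>
  define t where "t k = (case map_of (G (inv s k)) k of None \<Rightarrow> 0 | Some d \<Rightarrow> d) mod 2 ^ (h (Suc k) - h k)" for k
  obtain x where x: "\<And>k. \<exists>a<2 ^ h k. x \<in> dyadic (a * 2 ^ (h (Suc k) - h k) + t k) (h (Suc k))"
    using ex_real_with_digit_blocks[OF h, of t] by (auto simp: t_def)
  have "x \<notin> N i" if i: "i \<in> I" for i
  proof -
    obtain n where n: "G n = F i n"
      using infinite_imp_nonempty[OF G[OF i]] by (metis (mono_tags) empty_Collect_eq)
    let ?E = "enumerate (X i) ` {0..<Suc n}"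
    have infX: "infinite (X i)"
      using inf[OF i] by (simp add: X_def)
    have dom: "fst ` set (G n) = ?E"
      by (simp add: n F_def image_image del: upt_Suc)
    \<comment> \<open>A correct guess names \<open>n + 1\<close> distinct blocks, one more than the
      earlier stages can occupy, so \<open>s n\<close> is one of them.\<close>
    have "card ?E = Suc n"
      using infX by (subst card_image) (auto intro: inj_on_subset[OF strict_mono_imp_inj_on[OF strict_mono_enumerate]])
    then have sn: "s n \<in> ?E"
      using s(2)[of n] dom by simp
    then have "s n \<in> X i"
      using enumerate_in_set[OF infX] by auto
    then have E: "escapes (N i) (h (s n)) (h (Suc (s n))) (T i (s n))"
      by (rule T)
    have "map_of (G n) (s n) = Some (T i (s n))"
      unfolding n F_def using sn by (simp add: map_of_map_restrict restrict_map_def del: upt_Suc map_map)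
    then have "t (s n) = T i (s n)"
      using E by (simp add: t_def s(1) escapes_def)
    \<comment> \<open>Escaping holds for every prefix, so the digits of \<open>x\<close> before this
      block do not matter.\<close>
    with E x[of "s n"] show ?thesis
      unfolding escapes_def by auto
  qed
  then show ?thesis by blast
qed

section \<open>Cardinal bounds and the passage from nowhere dense to meager sets\<close>

lemma natLeq_less_continuum: "natLeq <o continuum"
  unfolding continuum_def by (rule ordLess_ctwo_cexp) (rule natLeq_Card_order)

lemma Times_nat_less_continuum:
  assumes "|C| <o continuum"
  shows "|C \<times> (UNIV :: nat set)| <o continuum"
proof (cases "finite C")
  case True
  then have "countable (C \<times> (UNIV :: nat set))"
    by (simp add: countable_finite)
  then have "|C \<times> (UNIV :: nat set)| \<le>o natLeq"
    by (meson card_of_nat card_of_ordLeqI inj_on_to_nat_on ordLeq_ordIso_trans UNIV_I)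
  then show ?thesis
    using natLeq_less_continuum ordLeq_ordLess_trans by blast
next
  case False
  then have "|UNIV :: nat set| \<le>o |C|"
    by (simp add: infinite_iff_card_of_nat)
  then have "|C \<times> (UNIV :: nat set)| =o |C|"
    using False by (simp add: card_of_Times_infinite)
  then show ?thesis
    using assms ordIso_ordLess_trans by blast
qed

lemma cov_meager_le_continuum: "cov_meager \<le>o continuum"
proof -
  have "cov_meager \<le>o |range (\<lambda>x::real. {x})|"
    using cov_meager_least meager_cover_singletons by blast
  also have "|range (\<lambda>x::real. {x})| \<le>o |UNIV :: real set|"
    by (rule card_of_image)
  also have "|UNIV :: real set| =o |UNIV :: nat set set|"
    using nat_sets_eqpoll_reals by (simp add: eqpoll_iff_card_of_ordIso ordIso_symmetric)
  also have "|UNIV :: nat set set| \<le>o continuum"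
    unfolding continuum_eq by (rule card_of_ordLeqI[where f = "\<lambda>A n. n \<in> A"]) (auto intro!: injI simp: fun_eq_iff)
  finally show ?thesis .
qed

theorem theorem3p4:
  assumes "SAT natLeq"
  shows "cov_meager =o continuum"
proof -
  obtain C where C: "meager_cover C" "cov_meager = |C|"
    using cov_meager_least by blast
  \<comment> \<open>A smaller cover would split into fewer than continuum many nowhere dense pieces,
    and some real avoids them all.\<close>
  have "\<not> |C| <o continuum"
  proof
    assume "|C| <o continuum"
    then have small: "|C \<times> (UNIV :: nat set)| <o continuum"
      by (rule Times_nat_less_continuum)
    have "\<forall>S\<in>C. \<exists>N :: nat \<Rightarrow> real set. (\<forall>n. nowhere_dense (N n)) \<and> S = (\<Union>n. N n)"
      using C(1) by (simp add: meager_cover_def meager_def)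
    then obtain N :: "real set \<Rightarrow> nat \<Rightarrow> real set"
      where N: "\<And>S n. S \<in> C \<Longrightarrow> nowhere_dense (N S n)" "\<And>S. S \<in> C \<Longrightarrow> S = (\<Union>n. N S n)"
      by metis
    obtain x where x: "\<And>S n. S \<in> C \<Longrightarrow> x \<notin> N S n"
      using SAT_escape_nowhere_dense[OF assms small, of "\<lambda>(S, n). N S n"] N(1) by fastforce
    have "x \<in> \<Union> C"
      using C(1) by (simp add: meager_cover_def)
    with N(2) x show False by blast
  qed
  then have "continuum \<le>o cov_meager"
    unfolding C(2) continuum_eq by (simp add: not_ordLess_iff_ordLeq card_of_Well_order)
  with cov_meager_le_continuum show ?thesis
    by (simp add: ordIso_iff_ordLeq)
qed

end
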